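(* The algorithm Maj has competitive function $\frac{n}{2}$.
   Context: Online frequent items problem: an input sequence is $I=a_1,\ldots,a_n$ of items from an infinite universe, $n=|I|$, revealed one at a time. An algorithm maintains a buffer holding one item; $s_t$ is the buffer content after step $t$; at step $1$ the buffer receives $a_1$, and at each later step $t$ the algorithm either keeps $s_{t-1}$ or replaces it by $a_t$. With $f_I(a)=|\{i:a_i=a\}|/n$, the aggregate frequency of $\mathcal A$ on $I$ is $\mathcal A(I)=\sum_{t=1}^n f_I(s^{\mathcal A}_t)$ (to be maximized). Opt denotes an optimal offline algorithm (knows all of $I$ in advance, same buffer rules). Maj keeps a counter, initially $0$: when an item arrives, if the counter is $0$ it buffers the item and sets the counter to $1$; otherwise, if the arriving item equals the buffered item the counter is incremented, else it is decremented (buffer unchanged). Competitive function: $\mathcal A$ is $f(n)$-competitive if there is $h\in o(f)$ such that for all $I$ (with $n=|I|$), $\mathrm{Opt}(I)\le (f(n)+h(n))\,\mathcal A(I)$. $\mathcal A$ has competitive function $f(n)$ if it is $f(n)$-competitive and for every $g(n)$ such that $\mathcal A$ is $g(n)$-competitive, $\lim_{n\to\infty} f(n)/g(n)\le 1$. *)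

theory Defs
  imports "HOL-Library.Landau_Symbols" "HOL-Library.Extended_Real"
begin

text \<open>Inputs are finite lists. Positions are 0-based, so step \<open>t + 1\<close> reads \<open>I ! t\<close>.\<close>

definition freq :: "'a list \<Rightarrow> 'a \<Rightarrow> real" where
  "freq I a = real (count_list I a) / real (length I)"

definition buffer_runs :: "'a list \<Rightarrow> 'a list set" where
  "buffer_runs I = {s. length s = length I \<and>
     (\<forall>t<length I. s ! t = I ! t \<or> (t > 0 \<and> s ! t = s ! (t - 1)))}"

definition agg_freq :: "'a list \<Rightarrow> 'a list \<Rightarrow> real" where
  "agg_freq I s = (\<Sum>t<length I. freq I (s ! t))"

definition opt :: "'a list \<Rightarrow> real" where
  "opt I = Max (agg_freq I ` buffer_runs I)"

text \<open>A (deterministic) online algorithm is a function from the nonempty prefix read so far to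
  the current buffer content; its value on the empty list is never used.\<close>

definition run :: "('a list \<Rightarrow> 'a) \<Rightarrow> 'a list \<Rightarrow> 'a list" where
  "run A I = map (\<lambda>t. A (take (Suc t) I)) [0..<length I]"

definition online_algorithm :: "('a list \<Rightarrow> 'a) \<Rightarrow> bool" where
  "online_algorithm A \<longleftrightarrow> (\<forall>I. run A I \<in> buffer_runs I)"

definition alg_value :: "('a list \<Rightarrow> 'a) \<Rightarrow> 'a list \<Rightarrow> real" where
  "alg_value A I = agg_freq I (run A I)"

fun maj_step :: "'a \<Rightarrow> 'a \<times> nat \<Rightarrow> 'a \<times> nat" where
  "maj_step a (b, c) =
     (if c = 0 then (a, 1) else if a = b then (b, c + 1) else (b, c - 1))"

text \<open>The initial buffer content is irrelevant: with counter 0, the first item overwrites it.\<close>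

definition maj :: "'a list \<Rightarrow> 'a" where
  "maj I = fst (fold maj_step I (undefined, 0))"

definition competitive :: "('a list \<Rightarrow> 'a) \<Rightarrow> (nat \<Rightarrow> real) \<Rightarrow> bool" where
  "competitive A f \<longleftrightarrow>
     (\<exists>h\<in>o(f). \<forall>I. opt I \<le> (f (length I) + h (length I)) * alg_value A I)"

text \<open>\<open>f n / g n\<close> need not converge for every admissible \<open>g\<close> (e.g. \<open>g\<close> equal to \<open>f\<close> at even and
  to \<open>2 * f\<close> at odd arguments), so the optimality requirement \<open>lim f / g \<le> 1\<close> is read as a
  bound on the limit superior, which is the limit whenever that exists. Competitiveness on inputs
  of every length forces \<open>g\<close> to be eventually positive, so division by zero plays no role.\<close>

definition has_competitive_function :: "('a list \<Rightarrow> 'a) \<Rightarrow> (nat \<Rightarrow> real) \<Rightarrow> bool" where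
  "has_competitive_function A f \<longleftrightarrow> competitive A f \<and>
     (\<forall>g. competitive A g \<longrightarrow> limsup (\<lambda>n. ereal (f n / g n)) \<le> 1)"

text \<open>The maximum in \<^const>\<open>opt\<close> is over a finite nonempty set, and \<^const>\<open>maj\<close> obeys the buffer
  rules.\<close>

lemma buffer_runs_subset:
  assumes "s \<in> buffer_runs I"
  shows "set s \<subseteq> set I"
proof -
  have "s ! t \<in> set I" if "t < length I" for t
    using that
  proof (induction t)
    case 0
    then show ?case using assms by (auto simp: buffer_runs_def)
  next
    case (Suc t)
    then have "s ! Suc t = I ! Suc t \<or> s ! Suc t = s ! t"
      using assms by (auto simp: buffer_runs_def)
    then show ?case using Suc by auto
  qed
  then show ?thesis
    using assms by (auto simp: buffer_runs_def in_set_conv_nth)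
qed

lemma finite_buffer_runs: "finite (buffer_runs I)"
proof (rule finite_subset)
  show "buffer_runs I \<subseteq> {s. set s \<subseteq> set I \<and> length s = length I}"
    using buffer_runs_subset by (auto simp: buffer_runs_def)
qed (simp add: finite_lists_length_eq)

lemma buffer_runs_nonempty: "buffer_runs I \<noteq> {}"
proof -
  have "I \<in> buffer_runs I" by (simp add: buffer_runs_def)
  then show ?thesis by blast
qed

lemma online_algorithm_maj: "online_algorithm maj"
proof -
  have "maj (take (Suc t) I) = I ! t \<or> (t > 0 \<and> maj (take (Suc t) I) = maj (take t I))"
    if "t < length I" for t and I :: "'a list"
  proof (cases "t = 0")
    case True
    with that show ?thesis by (simp add: maj_def take_Suc_conv_app_nth)
  next
    case False
    obtain b c where "fold maj_step (take t I) (undefined, 0) = (b, c)"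
      by (metis surj_pair)
    with that False show ?thesis by (simp add: maj_def take_Suc_conv_app_nth)
  qed
  note step = this
  have "run maj I ! t = I ! t \<or> (t > 0 \<and> run maj I ! t = run maj I ! (t - 1))"
    if "t < length I" for t and I :: "'a list"
    using step[OF that] that by (cases t) (auto simp: run_def)
  moreover have "length (run maj I) = length I" for I :: "'a list"
    by (simp add: run_def)
  ultimately show ?thesis
    by (simp add: online_algorithm_def buffer_runs_def)
qed

end

theory Submission
  imports Defs
begin

text \<open>Let \<open>m\<close> be the largest multiplicity of an item in \<open>I\<close>. Then \<open>opt I \<le> m\<close>, and \<open>maj\<close> has value
  at least \<open>1\<close>, so only \<open>m > n / 2\<close> is of interest. In that case the voting argument of Boyer and
  Moore puts the majority item into the final buffer; this one step already gives \<open>maj\<close> the value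
  \<open>(n - 1 + m) / n\<close>, which suffices for the ratio \<open>n / 2 + 1\<close>. Conversely, on
  \<open>x\<^sub>1, a, x\<^sub>2, a, \<dots>\<close> with distinct items \<open>x\<^sub>i\<close>, \<open>maj\<close> never buffers \<open>a\<close> and has value \<open>1\<close>, while
  holding \<open>a\<close> from the second step on has value at least \<open>n / 2 - 1\<close>.\<close>

section \<open>The majority vote\<close>

text \<open>The items read so far can be split into pairs of distinct items and \<open>c\<close>
  leftover copies of \<open>b\<close>; an item occurs at most once in each pair. The bound for
  \<open>b\<close> keeps the induction going: at counter 0 both bounds say that no item has a strict
  majority, whichever item is buffered next.\<close>

lemma maj_counter_invariant:
  fixes I :: "'a list"
  assumes "fold maj_step I (undefined, 0) = (b, c)"
  shows "2 * count_list I b \<le> length I + c"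
    and "a \<noteq> b \<Longrightarrow> 2 * count_list I a + c \<le> length I"
proof -
  have "2 * count_list I b \<le> length I + c \<and>
      (\<forall>a. a \<noteq> b \<longrightarrow> 2 * count_list I a + c \<le> length I)"
    using assms
  proof (induction I arbitrary: b c rule: rev_induct)
    case Nil
    then show ?case by simp
  next
    case (snoc x I)
    obtain b' c' where st: "fold maj_step I (undefined, 0) = (b', c')"
      by (metis surj_pair)
    note IH = snoc.IH[OF st]
    have le: "2 * count_list I a \<le> length I" if "c' = 0" for a
      using IH that by (cases "a = b'") auto
    show ?case
    proof (cases "c' = 0")
      case True
      then have "b = x" "c = 1" using snoc.prems st by auto
      then show ?thesis using le[OF True] by auto
    next
      case False
      show ?thesis
      proof (cases "x = b'")
        case True
        then have "b = b'" "c = c' + 1" using snoc.prems st False by auto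
        then show ?thesis using IH True by auto
      next
        case neq: False
        then have bc: "b = b'" "c = c' - 1" using snoc.prems st False by auto
        have "2 * count_list I x + c' \<le> length I" using IH neq by auto
        moreover have "2 * count_list I a + c' \<le> length I" if "a \<noteq> b'" for a
          using IH that by auto
        ultimately show ?thesis using IH neq bc False by fastforce
      qed
    qed
  qed
  then show "2 * count_list I b \<le> length I + c"
    and "a \<noteq> b \<Longrightarrow> 2 * count_list I a + c \<le> length I" by auto
qed

lemma maj_majority:
  assumes "2 * count_list I a > length I"
  shows "maj I = a"
proof -
  obtain b c where st: "fold maj_step I (undefined, 0) = (b, c)"
    by (metis surj_pair)
  have "a = b"
    using maj_counter_invariant(2)[OF st, of a] assms by fastforce
  then show ?thesis using st by (simp add: maj_def)
qed

section \<open>Bounds on the values of arbitrary runs\<close>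

lemma agg_freq_le_opt: "s \<in> buffer_runs I \<Longrightarrow> agg_freq I s \<le> opt I"
  by (simp add: opt_def finite_buffer_runs)

lemma opt_le:
  assumes "I \<noteq> []" "\<And>a. count_list I a \<le> m"
  shows "opt I \<le> real m"
proof -
  have "agg_freq I s \<le> real m" for s
  proof -
    have "agg_freq I s \<le> (\<Sum>t<length I. real m / real (length I))"
      unfolding agg_freq_def freq_def
      by (intro sum_mono divide_right_mono) (use assms in auto)
    then show ?thesis using assms(1) by simp
  qed
  then show ?thesis
    by (simp add: opt_def finite_buffer_runs buffer_runs_nonempty)
qed

lemma freq_ge:
  assumes "a \<in> set I"
  shows "freq I a \<ge> 1 / real (length I)"
proof -
  have "count_list I a \<ge> 1"
    using assms count_list_0_iff[of I a] by simp
  then show ?thesis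
    unfolding freq_def by (intro divide_right_mono) auto
qed

text \<open>Every buffered item occurs in \<open>I\<close>, so each step contributes at least 1/n.
  Only the last step is counted exactly, since the vote controls just the final buffer.\<close>

lemma agg_freq_ge:
  assumes s: "s \<in> buffer_runs I" and "I \<noteq> []"
  shows "agg_freq I s \<ge> (real (length I) - 1) / real (length I) + freq I (last s)"
proof -
  obtain k where k: "length I = Suc k"
    using \<open>I \<noteq> []\<close> by (cases I) auto
  have len: "length s = Suc k"
    using s k by (simp add: buffer_runs_def)
  then have last: "last s = s ! k"
    by (metis diff_Suc_1 last_conv_nth list.size(3) nat.distinct(1))
  have "(\<Sum>t<k. 1 / real (length I)) \<le> (\<Sum>t<k. freq I (s ! t))"
    using buffer_runs_subset[OF s] len
    by (intro sum_mono freq_ge) (auto simp: subset_iff)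
  then show ?thesis
    by (simp add: agg_freq_def k last)
qed

section \<open>Upper bound on the ratio\<close>

lemma maj_ratio:
  fixes I :: "'a list"
  shows "opt I \<le> (real (length I) / 2 + 1) * alg_value maj I"
proof (cases "I = []")
  case True
  then show ?thesis
    by (simp add: opt_def alg_value_def agg_freq_def buffer_runs_def)
next
  case False
  define n where "n = length I"
  have n: "n \<ge> 1" using False by (cases I) (auto simp: n_def)
  have "Max (count_list I ` set I) \<in> count_list I ` set I"
    using False by (intro Max_in) auto
  then obtain a where a: "a \<in> set I" "Max (count_list I ` set I) = count_list I a"
    by auto
  then have a_max: "count_list I b \<le> count_list I a" if "b \<in> set I" for b
    using that by (metis Max_ge List.finite_set finite_imageI imageI)
  define m where "m = count_list I a"
  have max: "count_list I b \<le> m" for b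
    using a_max by (cases "b \<in> set I") (auto simp: m_def)
  have opt: "opt I \<le> real m"
    using opt_le[OF False max] .
  have run: "run maj I \<in> buffer_runs I"
    using online_algorithm_maj by (auto simp: online_algorithm_def)
  have last: "last (run maj I) = maj I"
    using False by (simp add: run_def last_map last_conv_nth)
  have val: "alg_value maj I \<ge> (real n - 1) / real n + freq I (maj I)"
    using agg_freq_ge[OF run False] last by (simp add: alg_value_def n_def)
  have m1: "m \<ge> 1"
    using a(1) count_list_0_iff[of I a] by (simp add: m_def)
  show ?thesis
  proof (cases "2 * m \<le> n")
    case True
    have "run maj I \<noteq> []" using \<open>I \<noteq> []\<close> by (simp add: run_def)
    then have "last (run maj I) \<in> set I"
      using buffer_runs_subset[OF run] last_in_set by blast
    then have "freq I (maj I) \<ge> 1 / real n"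
      using freq_ge last by (metis n_def)
    moreover have "(real n - 1) / real n + 1 / real n = 1"
      using n by (simp add: field_simps)
    ultimately have "alg_value maj I \<ge> 1"
      using val by linarith
    have "real m \<le> (real n / 2 + 1) * 1" using True by simp
    also have "\<dots> \<le> (real n / 2 + 1) * alg_value maj I"
      using \<open>alg_value maj I \<ge> 1\<close> by (intro mult_left_mono) auto
    finally show ?thesis using opt by (simp add: n_def)
  next
    case False
    then have "maj I = a"
      by (intro maj_majority) (simp add: m_def n_def)
    then have v: "alg_value maj I \<ge> (real n - 1 + real m) / real n"
      using val by (simp add: freq_def m_def n_def add_divide_distrib)
    have "m \<le> n"
      by (simp add: m_def n_def count_le_length)
    \<comment> \<open>With the denominator \<open>n\<close> cleared, the claim is that a difference
      is nonnegative; it splits into three nonnegative terms. The summand 1 in the ratio pays for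
      the crude count of the earlier steps: for m = n the bound on the value is (2n - 1)/n, and n/2
      times this misses n by 1/2.\<close>
    then have "0 \<le> real n * (real n - real m)" by simp
    moreover have "(real n / 2 + 1) * (real n - 1 + real m) - real m * real n =
        real n * (real n - real m) / 2 + real n / 2 + (real m - 1)"
      by (simp add: field_simps)
    moreover have "real m - 1 \<ge> 0" using m1 by simp
    ultimately have "real m * real n \<le> (real n / 2 + 1) * (real n - 1 + real m)"
      by (smt (verit) divide_nonneg_pos of_nat_0_le_iff)
    then have "real m \<le> (real n / 2 + 1) * ((real n - 1 + real m) / real n)"
      using n by (simp add: field_simps)
    also have "\<dots> \<le> (real n / 2 + 1) * alg_value maj I"
      using v by (intro mult_left_mono) auto
    finally show ?thesis using opt by (simp add: n_def)
  qed
qed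

section \<open>Lower bound by a bad input\<close>

text \<open>Each even position finds counter 0 and is buffered; the odd position after it cancels
  it. \<open>2 * (t div 2)\<close> is the last even position up to \<open>t\<close>.\<close>

lemma maj_alternating:
  fixes y :: "nat \<Rightarrow> 'a"
  assumes "\<And>i. y (2 * i) \<noteq> y (Suc (2 * i))"
  shows "fold maj_step (map y [0..<Suc t]) (undefined, 0) =
    (y (2 * (t div 2)), if even t then 1 else 0)"
proof (induction t)
  case 0
  then show ?case by simp
next
  case (Suc t)
  have "fold maj_step (map y [0..<Suc (Suc t)]) (undefined, 0) =
      maj_step (y (Suc t)) (fold maj_step (map y [0..<Suc t]) (undefined, 0))"
    by simp
  also have "\<dots> = (y (2 * (Suc t div 2)), if even (Suc t) then 1 else 0)"
  proof (cases "even t")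
    case True
    then obtain k where "t = 2 * k" by blast
    then show ?thesis using Suc assms[of k] by auto
  next
    case False
    then obtain k where "t = 2 * k + 1" using oddE by blast
    then show ?thesis using Suc by auto
  qed
  finally show ?case .
qed

lemma maj_bad_input:
  assumes "infinite (UNIV :: 'a set)" and n: "n \<ge> 1"
  obtains I :: "'a list"
  where "length I = n" "alg_value maj I = 1" "opt I \<ge> real n / 2 - 1"
proof -
  obtain x :: "nat \<Rightarrow> 'a" where x: "inj x"
    using infinite_countable_subset[OF assms(1)] by auto
  \<comment> \<open>\<open>x 0\<close> is the repeated item; the shift by \<open>Suc\<close> keeps
    the one-time items different from it.\<close>
  define y where "y i = (if odd i then x 0 else x (Suc i))" for i
  define I where "I = map y [0..<n]"
  have len: "length I = n" by (simp add: I_def)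
  have y_even: "y i = y (2 * j) \<longleftrightarrow> i = 2 * j" for i j
    using x by (auto simp: y_def inj_eq)
  have y_odd: "y i = x 0 \<longleftrightarrow> odd i" for i
    using x by (auto simp: y_def inj_eq)
  have count_even: "count_list (map y [0..<k]) (y (2 * j)) = (if 2 * j < k then 1 else 0)" for k j
    by (induction k) (auto simp: y_even)
  have count_odd: "count_list (map y [0..<k]) (x 0) = k div 2" for k
    by (induction k) (auto simp: y_odd)
  have run_nth: "run maj I ! t = y (2 * (t div 2))" if "t < n" for t
  proof -
    have "take (Suc t) I = map y [0..<Suc t]"
      using that by (simp add: I_def take_map del: upt_Suc)
    moreover have "y (2 * i) \<noteq> y (Suc (2 * i))" for i
      using y_even[of "Suc (2 * i)" i] by auto
    ultimately show ?thesis
      using that maj_alternating[of y t] len by (simp add: run_def maj_def)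
  qed
  have "alg_value maj I = (\<Sum>t<n. 1 / real n)"
    unfolding alg_value_def agg_freq_def len
  proof (rule sum.cong)
    fix t assume "t \<in> {..<n}"
    then have "t < n" by simp
    moreover from this have "2 * (t div 2) < n" by linarith
    ultimately show "freq I (run maj I ! t) = 1 / real n"
      using count_even[of n "t div 2"] by (simp add: run_nth freq_def len) (simp add: I_def)
  qed simp
  then have val: "alg_value maj I = 1" using n by simp
  \<comment> \<open>The first buffer content is forced; \<open>x 0\<close> first arrives at position
    1 and is then held.\<close>
  define s where "s = map (\<lambda>t. if t = 0 then y 0 else x 0) [0..<n]"
  have "s \<in> buffer_runs I"
    by (auto simp: buffer_runs_def s_def I_def y_def)
  then have "agg_freq I s \<le> opt I" by (rule agg_freq_le_opt)
  moreover have "agg_freq I s \<ge> (real n - 1) * (real (n div 2) / real n)"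
  proof -
    obtain k where k: "n = Suc k" using n by (cases n) auto
    have "freq I (x 0) = real (n div 2) / real n"
      using count_odd[of n] by (simp add: freq_def len I_def)
    moreover have "agg_freq I s = freq I (s ! 0) + (\<Sum>t<k. freq I (s ! Suc t))"
      unfolding agg_freq_def len k by (rule sum.lessThan_Suc_shift)
    moreover have "(\<Sum>t<k. freq I (s ! Suc t)) = (\<Sum>t<k. freq I (x 0))"
      by (rule sum.cong) (auto simp: s_def k simp del: upt_Suc)
    moreover have "freq I (s ! 0) \<ge> 0" by (simp add: freq_def)
    ultimately show ?thesis by (simp add: k)
  qed
  moreover have "(real n - 1) * (real (n div 2) / real n) \<ge> real n / 2 - 1"
  proof -
    \<comment> \<open>Rounding down costs at most 1/2, and (n - 1)^2 / (2n) is still at least n/2 -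
      1.\<close>
    define d where "d = n div 2"
    have "n \<le> 2 * d + 1" unfolding d_def by presburger
    then have "real n \<le> real (2 * d + 1)" by (rule of_nat_mono)
    then have "real d \<ge> (real n - 1) / 2" by simp
    then have "(real n - 1) * ((real n - 1) / 2) \<le> (real n - 1) * real d"
      using n by (intro mult_left_mono) auto
    then show ?thesis using n unfolding d_def[symmetric] by (simp add: field_simps)
  qed
  ultimately have "opt I \<ge> real n / 2 - 1" by linarith
  with len val that show thesis by blast
qed

section \<open>Passage to the limit\<close>

lemma limsup_ratio_le_1:
  fixes f g h :: "nat \<Rightarrow> real"
  assumes f: "filterlim f at_top sequentially" and h: "h \<in> o(g)"
    and le: "\<forall>\<^sub>F n in sequentially. f n - C \<le> g n + h n"
  shows "limsup (\<lambda>n. ereal (f n / g n)) \<le> 1"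
proof (rule dense_ge)
  fix z :: ereal assume "1 < z"
  then obtain c where c: "1 < c" "ereal c \<le> z"
    by (metis ereal_dense2 less_ereal.simps(1) less_imp_le one_ereal_def)
  \<comment> \<open>chosen so that \<open>(1 + e) / (1 - e) = c\<close>\<close>
  define e where "e = (c - 1) / (c + 1)"
  have e: "0 < e" "e < 1" "1 + e = c * (1 - e)"
    using c by (auto simp: e_def field_simps)
  have "\<forall>\<^sub>F n in sequentially. norm (h n) \<le> e * norm (g n)"
    using landau_o.smallD[OF h e(1)] .
  \<comment> \<open>Beyond this threshold \<open>C\<close> is less than \<open>e * f n\<close>, so
    the additive constant becomes a relative error, like \<open>h\<close>.\<close>
  moreover have "\<forall>\<^sub>F n in sequentially. \<bar>C\<bar> / e + 1 \<le> f n"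
    using f by (simp add: filterlim_at_top)
  ultimately have "\<forall>\<^sub>F n in sequentially. ereal (f n / g n) \<le> ereal c"
    using le
  proof eventually_elim
    case (elim n)
    have "\<bar>C\<bar> + e \<le> e * f n"
      using elim(2) e(1) by (simp add: field_simps)
    moreover have "h n \<le> e * \<bar>g n\<bar>" using elim(1) by simp
    ultimately have low: "(1 - e) * f n < g n + e * \<bar>g n\<bar>"
      using elim(3) e(1) by (simp add: algebra_simps)
    have "f n > 0"
      using elim(2) e(1) by (smt (verit) divide_nonneg_pos)
    then have "(1 - e) * f n > 0" using e by simp
    \<comment> \<open>The sign of \<open>g n\<close> is not given; a nonpositive value would
      contradict the positive lower bound \<open>low\<close>.\<close>
    moreover have "g n + e * \<bar>g n\<bar> \<le> 0" if "g n \<le> 0"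
    proof -
      have "(1 - e) * g n \<le> 0" using that e by (simp add: mult_nonneg_nonpos)
      with that show ?thesis by (simp add: algebra_simps)
    qed
    ultimately have g: "g n > 0" using low by linarith
    then have "(1 - e) * f n < (1 + e) * g n" using low by (simp add: algebra_simps)
    also have "\<dots> = (1 - e) * (c * g n)" using e(3) by simp
    finally have "f n \<le> c * g n" using e(2) by simp
    then show ?case using g by (simp add: field_simps)
  qed
  then have "limsup (\<lambda>n. ereal (f n / g n)) \<le> ereal c"
    by (rule Limsup_bounded)
  with c(2) show "limsup (\<lambda>n. ereal (f n / g n)) \<le> z" by (rule order_trans[rotated])
qed

theorem theorem3:
  assumes "infinite (UNIV :: 'a set)"
  shows "has_competitive_function (maj :: 'a list \<Rightarrow> 'a) (\<lambda>n. real n / 2)"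
  unfolding has_competitive_function_def
proof (intro conjI allI impI)
  have lim: "filterlim (\<lambda>n. real n / 2) at_top sequentially"
    using filterlim_tendsto_pos_mult_at_top[OF tendsto_const[of "1 / 2 :: real"] _ filterlim_real_sequentially]
    by simp
  have "(\<lambda>n. 1) \<in> o(\<lambda>n. real n / 2)"
  proof (rule landau_o.smallI)
    fix c :: real assume "c > 0"
    have "\<forall>\<^sub>F n in sequentially. 1 / c \<le> real n / 2"
      using lim unfolding filterlim_at_top by blast
    then show "\<forall>\<^sub>F n in sequentially. norm (1 :: real) \<le> c * norm (real n / 2)"
      by eventually_elim (use \<open>c > 0\<close> in \<open>simp add: field_simps\<close>)
  qed
  then show "competitive (maj :: 'a list \<Rightarrow> 'a) (\<lambda>n. real n / 2)"
    unfolding competitive_def using maj_ratio by (intro bexI[of _ "\<lambda>_. 1"]) auto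
  fix g
  assume "competitive (maj :: 'a list \<Rightarrow> 'a) g"
  then obtain h where h: "h \<in> o(g)"
    and le: "\<And>I :: 'a list. opt I \<le> (g (length I) + h (length I)) * alg_value maj I"
    by (auto simp: competitive_def)
  \<comment> \<open>On the bad input of length \<open>n\<close> the value of \<open>maj\<close> is
    1, so competitiveness bounds \<open>g n + h n\<close> itself from below.\<close>
  have "real n / 2 - 1 \<le> g n + h n" if "n \<ge> 1" for n
  proof -
    obtain I :: "'a list" where "length I = n" "alg_value maj I = 1" "opt I \<ge> real n / 2 - 1"
      using maj_bad_input[OF assms \<open>n \<ge> 1\<close>] .
    with le[of I] show ?thesis by simp
  qed
  then have "\<forall>\<^sub>F n in sequentially. real n / 2 - 1 \<le> g n + h n"
    by (rule eventually_sequentiallyI)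
  with lim h show "limsup (\<lambda>n. ereal (real n / 2 / g n)) \<le> 1"
    by (intro limsup_ratio_le_1)
qed

end
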